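(* Let $G$ be a graph (loops and multiple edges allowed) and let $d,t$ be positive integers with $d\ge \max\{2t,\,t(t-1)\}$. Then $G^{[d-t]}$ can be realised as an infinitesimally rigid linearly-constrained framework in $\mathbb{R}^d$ if and only if $G$ has a $(t,0)$-tight looped simple spanning subgraph.
   Context: A graph $G=(V,E,L)$ is finite and may contain multiple edges and loops; $V$, $E$, $L$ are its sets of vertices, (non-loop) edges and loops. A looped simple graph is a graph with no multiple (parallel non-loop) edges, but which may contain loops, possibly several at the same vertex. A spanning subgraph of $G$ is a subgraph with vertex set $V$. For $F\subseteq E\cup L$, $V_F$ denotes the set of vertices incident to $F$. $G$ is $(k,\ell)$-sparse if $|F|\le k|V_F|-\ell$ for all $\emptyset\ne F\subseteq E\cup L$; it is $(k,\ell)$-tight if it is $(k,\ell)$-sparse and $|E|+|L|=k|V|-\ell$. $G^{[k]}$ denotes the graph obtained from $G$ by adding $k$ (new) loops at each vertex of $G$. A linearly-constrained framework in $\mathbb{R}^d$ is a triple $(G,p,q)$ where $G=(V,E,L)$ is a graph, $p:V\to\mathbb{R}^d$ and $q:L\to\mathbb{R}^d$; it is also called a realisation of $G$ in $\mathbb{R}^d$. An infinitesimal motion of $(G,p,q)$ is a map $\dot p:V\to\mathbb{R}^d$ such that $(p(u)-p(v))\cdot(\dot p(u)-\dot p(v))=0$ for every edge $uv\in E$, and $q(e)\cdot\dot p(v)=0$ for every loop $e\in L$ incident to the vertex $v$. The framework is infinitesimally rigid if its only infinitesimal motion is $\dot p=0$ (equivalently, the coefficient matrix of this linear system, the rigidity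 matrix, has rank $d|V|$). "A graph can be realised as an infinitesimally rigid linearly-constrained framework in $\mathbb{R}^d$" means that there exist $p,q$ such that $(G,p,q)$ is infinitesimally rigid. *)

theory Defs
  imports "HOL-Analysis.Analysis"
begin

text \<open>
  Finite undirected multigraphs with loops. Edges and loops are named objects, so that parallel
  edges and several loops at one vertex are possible; \<open>ends\<close> maps a non-loop edge to the
  two-element set of its end vertices, and a loop to the singleton of its vertex. In particular
  \<open>edges\<close> and \<open>loops\<close> of a multigraph are disjoint.
\<close>

record ('v, 'e) multigraph =
  verts :: "'v set"
  edges :: "'e set"
  loops :: "'e set"
  ends :: "'e \<Rightarrow> 'v set"

definition is_multigraph :: "('v, 'e) multigraph \<Rightarrow> bool" where
  "is_multigraph G \<longleftrightarrow>
     finite (verts G) \<and> finite (edges G) \<and> finite (loops G) \<and>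
     (\<forall>e\<in>edges G. ends G e \<subseteq> verts G \<and> card (ends G e) = 2) \<and>
     (\<forall>e\<in>loops G. ends G e \<subseteq> verts G \<and> card (ends G e) = 1)"

lemma edges_loops_disjoint: "is_multigraph G \<Longrightarrow> edges G \<inter> loops G = {}"
  by (force simp: is_multigraph_def)

definition looped_simple :: "('v, 'e) multigraph \<Rightarrow> bool" where
  "looped_simple G \<longleftrightarrow> is_multigraph G \<and> inj_on (ends G) (edges G)"

definition subgraph :: "('v, 'e) multigraph \<Rightarrow> ('v, 'e) multigraph \<Rightarrow> bool" where
  "subgraph H G \<longleftrightarrow>
     is_multigraph H \<and> is_multigraph G \<and>
     verts H \<subseteq> verts G \<and> edges H \<subseteq> edges G \<and> loops H \<subseteq> loops G \<and>
     (\<forall>e\<in>edges H \<union> loops H. ends H e = ends G e)"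

definition spanning_subgraph :: "('v, 'e) multigraph \<Rightarrow> ('v, 'e) multigraph \<Rightarrow> bool" where
  "spanning_subgraph H G \<longleftrightarrow> subgraph H G \<and> verts H = verts G"

definition incident_verts :: "('v, 'e) multigraph \<Rightarrow> 'e set \<Rightarrow> 'v set" where
  "incident_verts G F = (\<Union>e\<in>F. ends G e)"

text \<open>The counts below live in \<^typ>\<open>int\<close>, since the differences may be negative.\<close>

definition sparse :: "nat \<Rightarrow> nat \<Rightarrow> ('v, 'e) multigraph \<Rightarrow> bool" where
  "sparse k l G \<longleftrightarrow>
     (\<forall>F. F \<noteq> {} \<and> F \<subseteq> edges G \<union> loops G \<longrightarrow>
        int (card F) \<le> int k * int (card (incident_verts G F)) - int l)"

definition tight :: "nat \<Rightarrow> nat \<Rightarrow> ('v, 'e) multigraph \<Rightarrow> bool" where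
  "tight k l G \<longleftrightarrow>
     sparse k l G \<and>
     int (card (edges G)) + int (card (loops G)) = int k * int (card (verts G)) - int l"

text \<open>
  \<open>add_loops k G\<close> is the graph $G^{[k]}$. Its new loops at a vertex \<open>v\<close> are
  \<open>Inr (v, 0), \<dots>, Inr (v, k - 1)\<close>; the original edges and loops are tagged with \<open>Inl\<close>.
\<close>

definition add_loops :: "nat \<Rightarrow> ('v, 'e) multigraph \<Rightarrow> ('v, 'e + 'v \<times> nat) multigraph" where
  "add_loops k G =
     \<lparr> verts = verts G,
       edges = Inl ` edges G,
       loops = Inl ` loops G \<union> Inr ` (verts G \<times> {..<k}),
       ends = case_sum (ends G) (\<lambda>(v, i). {v}) \<rparr>"

lemma is_multigraph_add_loops: "is_multigraph G \<Longrightarrow> is_multigraph (add_loops k G)"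
  by (auto simp: is_multigraph_def add_loops_def subset_iff)

text \<open>
  Maps on the vertex (loop) set are represented by total functions whose values elsewhere are
  irrelevant; accordingly a motion counts as zero if it vanishes on the vertices.
\<close>

definition infinitesimal_motion ::
    "('v, 'e) multigraph \<Rightarrow> ('v \<Rightarrow> real ^ 'd) \<Rightarrow> ('e \<Rightarrow> real ^ 'd) \<Rightarrow> ('v \<Rightarrow> real ^ 'd) \<Rightarrow> bool" where
  "infinitesimal_motion G p q p' \<longleftrightarrow>
     (\<forall>e\<in>edges G. \<forall>u v. ends G e = {u, v} \<longrightarrow> (p u - p v) \<bullet> (p' u - p' v) = 0) \<and>
     (\<forall>e\<in>loops G. \<forall>v\<in>ends G e. q e \<bullet> p' v = 0)"

definition infinitesimally_rigid ::
    "('v, 'e) multigraph \<Rightarrow> ('v \<Rightarrow> real ^ 'd) \<Rightarrow> ('e \<Rightarrow> real ^ 'd) \<Rightarrow> bool" where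
  "infinitesimally_rigid G p q \<longleftrightarrow>
     (\<forall>p'. infinitesimal_motion G p q p' \<longrightarrow> (\<forall>v\<in>verts G. p' v = 0))"

end

theory Submission
  imports Defs "HOL-Computational_Algebra.Polynomial"
begin

text \<open>
  Write \<open>d\<close> for the dimension. The \<open>d - t\<close> new loops at a vertex \<open>v\<close> confine its velocity to a
  subspace \<open>U v\<close> of dimension at least \<open>t\<close>, with equality if their normals are independent.

  If the graph with the new loops is rigid, restrict the motions to subspaces of \<open>U v\<close> of dimension exactly
  \<open>t\<close>, with a basis \<open>b v 0, \<dots>, b v (t - 1)\<close>. The edges and loops of \<open>G\<close> become the rows of a
  linear system in \<open>t |V|\<close> unknowns with trivial kernel, so \<open>t |V|\<close> of the rows are independent
  (\<open>trivial_kernel_imp_independent_rows\<close>). The corresponding edges and loops form the required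
  subgraph: a set \<open>F\<close> of them has rows supported on the \<open>t |V_F|\<close> unknowns of its incident
  vertices, so independence bounds \<open>|F|\<close> by \<open>t |V_F|\<close>, and parallel edges have equal rows.

  Conversely, for a tight looped simple graph, sparsity is Hall's condition for assigning every edge and
  loop to one of its ends in such a way that no vertex receives more than \<open>t\<close>, and the total count
  makes this exactly \<open>t\<close>. Regard an edge as an arc that leaves the vertex to which it is assigned.
  The vertices can be ordered so that at most \<open>t\<close> arcs enter each vertex from earlier ones
  (\<open>vertex_order_few_earlier_in_arcs\<close>). Put the vertices at points \<open>p v\<close> in general position.
  At a vertex \<open>v\<close>, let the new loops force the velocity of \<open>v\<close> to be orthogonal to \<open>p v - p w\<close>
  for all arcs entering \<open>v\<close> from an earlier \<open>w\<close>. An arc from \<open>u\<close> to a later vertex \<open>v\<close> then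
  constrains the velocity of \<open>u\<close> alone. So the linear system is block triangular: if the velocities
  of the earlier vertices vanish, each of the \<open>t\<close> arcs and loops assigned to \<open>u\<close> makes the
  velocity of \<open>u\<close> orthogonal to one vector. The diagonal block at \<open>u\<close> is nonsingular if
  these \<open>t\<close> vectors and the \<open>d - t\<close> normals of the new loops together span the space. The
  vectors prescribed by arcs are differences from \<open>p u\<close> to at most \<open>2 t\<close> other points, distinct
  because there are no parallel edges; as \<open>2 t \<le> d\<close>, they are independent, and the remaining
  normals can be chosen to complete them to a basis (\<open>complete_to_spanning_normals\<close>).
\<close>

section \<open>Homogeneous linear systems over finite index sets\<close>

text \<open>
  Gaussian elimination: an equation that involves some unknown \<open>x0\<close> is used to eliminate it from
  the other equations, and then determines \<open>x0\<close>.
\<close>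

lemma underdetermined_system_has_nonzero_solution:
  fixes a :: "'y \<Rightarrow> 'x \<Rightarrow> real"
  assumes "finite Y" "finite X" "card Y < card X"
  shows "\<exists>c. (\<exists>x\<in>X. c x \<noteq> 0) \<and> (\<forall>y\<in>Y. (\<Sum>x\<in>X. a y x * c x) = 0)"
  using assms
proof (induction Y arbitrary: X a rule: finite_induct)
  case empty
  then have "X \<noteq> {}" by auto
  then show ?case by (intro exI[of _ "\<lambda>_. 1"]) auto
next
  case (insert y0 Y)
  show ?case
  proof (cases "\<forall>x\<in>X. a y0 x = 0")
    case True
    have "card Y < card X" using insert by auto
    from insert.IH[OF insert.prems(1) this, of a] True show ?thesis by auto
  next
    case False
    then obtain x0 where x0: "x0 \<in> X" "a y0 x0 \<noteq> 0" by auto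
    define X' where "X' = X - {x0}"
    have fin: "finite X'" and X: "X = insert x0 X'" "x0 \<notin> X'"
      using x0 insert.prems by (auto simp: X'_def)
    then have "card Y < card X'" using insert by auto
    from insert.IH[OF fin this, of "\<lambda>y x. a y x - a y x0 * a y0 x / a y0 x0"]
    obtain c where c: "\<exists>x\<in>X'. c x \<noteq> 0"
      "\<And>y. y \<in> Y \<Longrightarrow> (\<Sum>x\<in>X'. (a y x - a y x0 * a y0 x / a y0 x0) * c x) = 0"
      by blast
    define s where "s = (\<Sum>x\<in>X'. a y0 x * c x)"
    define c' where "c' = c(x0 := - s / a y0 x0)"
    have sum: "(\<Sum>x\<in>X. a y x * c' x) = (\<Sum>x\<in>X'. a y x * c x) - a y x0 * s / a y0 x0" for y
    proof -
      have "(\<Sum>x\<in>X'. a y x * c' x) = (\<Sum>x\<in>X'. a y x * c x)"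
        using X by (intro sum.cong) (auto simp: c'_def)
      then show ?thesis using X fin by (simp add: c'_def)
    qed
    have "(\<Sum>x\<in>X. a y x * c' x) = 0" if "y \<in> Y" for y
    proof -
      have "(\<Sum>x\<in>X'. (a y x - a y x0 * a y0 x / a y0 x0) * c x)
          = (\<Sum>x\<in>X'. a y x * c x) - a y x0 / a y0 x0 * s"
        unfolding s_def sum_distrib_left sum_subtractf[symmetric]
        by (intro sum.cong) (auto simp: algebra_simps)
      then show ?thesis using c(2)[OF that] sum[of y] by simp
    qed
    moreover have "(\<Sum>x\<in>X. a y0 x * c' x) = 0"
      using sum[of y0] x0 by (simp add: s_def)
    moreover have "\<exists>x\<in>X. c' x \<noteq> 0"
      using c(1) X by (auto simp: c'_def)
    ultimately show ?thesis by auto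
  qed
qed

definition independent_rows :: "('y \<Rightarrow> 'x \<Rightarrow> real) \<Rightarrow> 'x set \<Rightarrow> 'y set \<Rightarrow> bool" where
  "independent_rows a X F \<longleftrightarrow>
     (\<forall>c. (\<forall>x\<in>X. (\<Sum>y\<in>F. c y * a y x) = 0) \<longrightarrow> (\<forall>y\<in>F. c y = 0))"

text \<open>
  More rows than columns in their support would admit a nontrivial relation, as its coefficients
  solve the transposed system, which is underdetermined.
\<close>

lemma independent_rows_card_le:
  assumes ind: "independent_rows a X F" and fin: "finite F" "finite S"
    and F': "F' \<subseteq> F" and supp: "\<And>y x. y \<in> F' \<Longrightarrow> x \<in> X - S \<Longrightarrow> a y x = 0"
  shows "card F' \<le> card S"
proof (rule ccontr)
  assume "\<not> ?thesis"
  with underdetermined_system_has_nonzero_solution[of S F' "\<lambda>x y. a y x"] fin F'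
  obtain c where c: "\<exists>y\<in>F'. c y \<noteq> 0" "\<forall>x\<in>S. (\<Sum>y\<in>F'. a y x * c y) = 0"
    using finite_subset by (metis not_le)
  define c' where "c' y = (if y \<in> F' then c y else 0)" for y
  have "(\<Sum>y\<in>F. c' y * a y x) = 0" if "x \<in> X" for x
  proof -
    have "(\<Sum>y\<in>F. c' y * a y x) = (\<Sum>y\<in>F'. a y x * c y)"
      using F' fin(1) by (intro sum.mono_neutral_cong_right) (auto simp: c'_def)
    also have "\<dots> = 0"
      using c(2) supp that by (cases "x \<in> S") auto
    finally show ?thesis .
  qed
  then have "\<forall>y\<in>F. c' y = 0"
    using ind unfolding independent_rows_def by blast
  then have "c y = 0" if "y \<in> F'" for y
    using F' that unfolding c'_def by (metis subsetD)
  with c(1) show False by blast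
qed

text \<open>
  Row rank equals column rank: an inclusion-minimal set of rows that still has trivial kernel is
  independent, because a row that depends on the others could be dropped.
\<close>

lemma trivial_kernel_imp_independent_rows:
  fixes a :: "'y \<Rightarrow> 'x \<Rightarrow> real"
  assumes fin: "finite Y" "finite X"
    and ker: "\<And>c. (\<forall>y\<in>Y. (\<Sum>x\<in>X. a y x * c x) = 0) \<Longrightarrow> (\<forall>x\<in>X. c x = 0)"
  obtains F where "F \<subseteq> Y" "independent_rows a X F" "card F = card X"
proof -
  define P where
    "P F \<longleftrightarrow> F \<subseteq> Y \<and> (\<forall>c. (\<forall>y\<in>F. (\<Sum>x\<in>X. a y x * c x) = 0) \<longrightarrow> (\<forall>x\<in>X. c x = 0))" for F
  have "P Y" using ker by (auto simp: P_def)
  from ex_has_least_nat[of P Y card, OF this]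
  obtain F where F: "P F" and min: "\<And>F'. P F' \<Longrightarrow> card F \<le> card F'" by auto
  have FY: "F \<subseteq> Y" and finF: "finite F"
    using F fin finite_subset by (auto simp: P_def)
  have ind: "independent_rows a X F"
    unfolding independent_rows_def
  proof (intro allI impI ballI, rule ccontr)
    fix c y0
    assume c: "\<forall>x\<in>X. (\<Sum>y\<in>F. c y * a y x) = 0" and y0: "y0 \<in> F" "c y0 \<noteq> 0"
    have "P (F - {y0})"
      unfolding P_def
    proof (intro conjI allI impI)
      fix z assume z: "\<forall>y\<in>F - {y0}. (\<Sum>x\<in>X. a y x * z x) = 0"
      have "0 = (\<Sum>x\<in>X. (\<Sum>y\<in>F. c y * a y x) * z x)"
        using c by simp
      also have "\<dots> = (\<Sum>y\<in>F. c y * (\<Sum>x\<in>X. a y x * z x))"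
        unfolding sum_distrib_left sum_distrib_right
        by (subst sum.swap) (simp add: mult.assoc)
      also have "\<dots> = c y0 * (\<Sum>x\<in>X. a y0 x * z x)"
        using z y0 finF by (subst sum.remove[of _ y0]) auto
      finally have "(\<Sum>x\<in>X. a y0 x * z x) = 0" using y0 by simp
      then have "\<forall>y\<in>F. (\<Sum>x\<in>X. a y x * z x) = 0" using z by auto
      then show "\<forall>x\<in>X. z x = 0" using F by (auto simp: P_def)
    qed (use FY in auto)
    from min[OF this] y0 finF show False
      by (metis card_Diff1_less not_le)
  qed
  have "card F \<le> card X"
    by (rule independent_rows_card_le[OF ind finF fin(2)]) auto
  moreover have "card X \<le> card F"
  proof (rule ccontr)
    assume "\<not> ?thesis"
    then obtain c where "\<exists>x\<in>X. c x \<noteq> 0" "\<forall>y\<in>F. (\<Sum>x\<in>X. a y x * c x) = 0"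
      using underdetermined_system_has_nonzero_solution[of F X a] finF fin(2) by auto
    then show False using F by (auto simp: P_def)
  qed
  ultimately show thesis using that FY ind by simp
qed

section \<open>Orientations and vertex orders\<close>

text \<open>
  Hall's marriage theorem in which every target may be used \<open>k\<close> times. Following Rado, the
  candidate sets are shrunk to singletons: if neither of two candidates \<open>x\<close>, \<open>y\<close> of \<open>e\<close> could be
  discarded, then the union of the two violating families and their intersection
  without \<open>e\<close> could not both satisfy Hall's condition.
\<close>

lemma capacitated_Hall:
  fixes A :: "'e \<Rightarrow> 'v set"
  assumes fin: "finite E" "\<And>e. e \<in> E \<Longrightarrow> finite (A e)"
    and hall: "\<And>F. F \<subseteq> E \<Longrightarrow> card F \<le> k * card (\<Union>(A ` F))"
  shows "\<exists>f. (\<forall>e\<in>E. f e \<in> A e) \<and> (\<forall>v. card {e\<in>E. f e = v} \<le> k)"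
  using fin(2) hall
proof (induction "\<Sum>e\<in>E. card (A e)" arbitrary: A rule: less_induct)
  case (less A)
  have nonempty: "A e \<noteq> {}" if "e \<in> E" for e
    using less.prems(2)[of "{e}"] that by auto
  show ?case
  proof (cases "\<exists>e\<in>E. \<exists>x\<in>A e. \<exists>y\<in>A e. x \<noteq> y")
    case False
    then have single: "A e = {SOME x. x \<in> A e}" if "e \<in> E" for e
      using nonempty that some_in_eq[of "A e"] by auto
    have "card {e\<in>E. (SOME x. x \<in> A e) = v} \<le> k" for v
    proof -
      let ?F = "{e\<in>E. (SOME x. x \<in> A e) = v}"
      have "\<Union>(A ` ?F) \<subseteq> {v}" using single by auto
      then have "card (\<Union>(A ` ?F)) \<le> 1"
        by (metis card_mono card.empty card_insert_disjoint finite.simps empty_iff One_nat_def)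
      with less.prems(2)[of ?F] show ?thesis
        by (metis (no_types, lifting) mem_Collect_eq mult.right_neutral mult_le_mono2 order_trans subsetI)
    qed
    with nonempty show ?thesis
      by (intro exI[of _ "\<lambda>e. SOME x. x \<in> A e"]) (auto simp: some_in_eq)
  next
    case True
    then obtain e0 x y where e0: "e0 \<in> E" and xy: "x \<in> A e0" "y \<in> A e0" "x \<noteq> y" by blast
    define B where "B z = A(e0 := A e0 - {z})" for z
    define hallB where "hallB z \<longleftrightarrow> (\<forall>F\<subseteq>E. card F \<le> k * card (\<Union>(B z ` F)))" for z
    have finB: "finite (B z e)" if "e \<in> E" for z e
      using less.prems(1) that e0 by (auto simp: B_def)
    have shrink: ?thesis if z: "z \<in> A e0" "hallB z" for z
    proof -
      have "(\<Sum>e\<in>E. card (B z e)) < (\<Sum>e\<in>E. card (A e))"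
      proof (rule sum_strict_mono_ex1)
        show "\<forall>e\<in>E. card (B z e) \<le> card (A e)"
          using less.prems(1) by (auto simp: B_def intro: card_mono)
        show "\<exists>e\<in>E. card (B z e) < card (A e)"
          using e0 card_Diff1_less[OF less.prems(1)[OF e0] z(1)]
          by (intro bexI[of _ e0]) (simp_all only: B_def fun_upd_same)
      qed (rule fin)
      from less.hyps[OF this finB] z(2) obtain f
        where "\<forall>e\<in>E. f e \<in> B z e" "\<forall>v. card {e\<in>E. f e = v} \<le> k"
        by (auto simp: hallB_def)
      moreover have "B z e \<subseteq> A e" for e by (auto simp: B_def)
      ultimately show ?thesis by blast
    qed
    have "hallB x \<or> hallB y"
    proof (rule ccontr)
      assume "\<not> ?thesis"
      then obtain F1 F2 where F: "F1 \<subseteq> E" "F2 \<subseteq> E"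
        and viol: "k * card (\<Union>(B x ` F1)) < card F1" "k * card (\<Union>(B y ` F2)) < card F2"
        unfolding hallB_def by (meson not_le)
      have in_viol: "e0 \<in> F" if "F \<subseteq> E" "k * card (\<Union>(B z ` F)) < card F" for F z
      proof (rule ccontr)
        assume "e0 \<notin> F"
        then have "B z ` F = A ` F" by (auto simp: B_def)
        then show False using less.prems(2)[OF that(1)] that(2) by simp
      qed
      have e0F: "e0 \<in> F1" "e0 \<in> F2" using in_viol F viol by blast+
      define N1 N2 where "N1 = \<Union>(B x ` F1)" and "N2 = \<Union>(B y ` F2)"
      have finF: "finite F1" "finite F2" using F fin(1) finite_subset by blast+
      then have finN: "finite N1" "finite N2"
        using finB F unfolding N1_def N2_def by blast+
      have un: "\<Union>(A ` (F1 \<union> F2)) \<subseteq> N1 \<union> N2"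
        using e0F xy by (auto simp: N1_def N2_def B_def split: if_splits)
      have int: "\<Union>(A ` (F1 \<inter> F2 - {e0})) \<subseteq> N1 \<inter> N2"
        by (auto simp: N1_def N2_def B_def split: if_splits)
      have "card (F1 \<union> F2) \<le> k * card (N1 \<union> N2)"
        using less.prems(2)[of "F1 \<union> F2"] F card_mono[OF _ un] finN
        by (meson finite_UnI le_sup_iff mult_le_mono2 order_trans)
      moreover have "card (F1 \<inter> F2 - {e0}) \<le> k * card (N1 \<inter> N2)"
        using less.prems(2)[of "F1 \<inter> F2 - {e0}"] F card_mono[OF _ int] finN
        by (meson finite_Int inf.coboundedI1 Diff_subset mult_le_mono2 order_trans)
      moreover have "card (F1 \<inter> F2) = Suc (card (F1 \<inter> F2 - {e0}))"
        using finF e0F by (intro card.remove) auto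
      moreover have "k * card N1 + k * card N2 = k * card (N1 \<union> N2) + k * card (N1 \<inter> N2)"
        using card_Un_Int[OF finN] by (metis distrib_left)
      moreover have "card F1 + card F2 = card (F1 \<union> F2) + card (F1 \<inter> F2)"
        using card_Un_Int[OF finF] .
      ultimately show False using viol unfolding N1_def[symmetric] N2_def[symmetric] by linarith
    qed
    then show ?thesis using shrink xy by blast
  qed
qed

text \<open>
  If at most \<open>t\<close> arcs leave each vertex, then in every nonempty vertex set the average number
  of arcs entering a vertex from within the set is at most \<open>t\<close>; a vertex that does not exceed
  this bound is put last, and the order is continued downwards on the remaining vertices.
\<close>

lemma vertex_order_few_earlier_in_arcs:
  fixes tail head :: "'e \<Rightarrow> 'v"
  assumes "finite V" "finite E" and out: "\<And>v. card {e\<in>E. tail e = v} \<le> t"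
  shows "\<exists>r. bij_betw r V {..<card V} \<and>
           (\<forall>v\<in>V. card {e\<in>E. head e = v \<and> tail e \<in> V \<and> r (tail e) < (r v :: nat)} \<le> t)"
  using assms(1)
proof (induction V rule: finite_psubset_induct)
  case (psubset V)
  show ?case
  proof (cases "V = {}")
    case True
    then show ?thesis by (auto simp: bij_betw_def)
  next
    case False
    have "\<exists>v\<in>V. card {e\<in>E. head e = v \<and> tail e \<in> V} \<le> t"
    proof (rule ccontr)
      assume "\<not> ?thesis"
      then have "(\<Sum>v\<in>V. t) < (\<Sum>v\<in>V. card {e\<in>E. head e = v \<and> tail e \<in> V})"
        using psubset.hyps False by (intro sum_strict_mono) auto
      also have "\<dots> = card (\<Union>v\<in>V. {e\<in>E. head e = v \<and> tail e \<in> V})"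
        using psubset.hyps assms(2) by (intro card_UN_disjoint[symmetric]) auto
      also have "\<dots> \<le> card (\<Union>v\<in>V. {e\<in>E. tail e = v})"
        using psubset.hyps assms(2) by (intro card_mono) auto
      also have "\<dots> \<le> (\<Sum>v\<in>V. card {e\<in>E. tail e = v})"
        using psubset.hyps by (rule card_UN_le)
      also have "\<dots> \<le> (\<Sum>v\<in>V. t)" using out by (intro sum_mono)
      finally show False by simp
    qed
    then obtain v where v: "v \<in> V" "card {e\<in>E. head e = v \<and> tail e \<in> V} \<le> t" by blast
    then have "V - {v} \<subset> V" by auto
    from psubset.IH[OF this] obtain r where
      bij: "bij_betw r (V - {v}) {..<card (V - {v})}" and
      r: "\<And>w. w \<in> V - {v} \<Longrightarrow>
        card {e\<in>E. head e = w \<and> tail e \<in> V - {v} \<and> r (tail e) < r w} \<le> t" by blast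
    define n where "n = card (V - {v})"
    define r' where "r' = r(v := n)"
    have cV: "card V = Suc n"
      using card.remove[OF psubset.hyps v(1)] unfolding n_def .
    have "bij_betw r' (V - {v}) {..<n}"
      using bij bij_betw_cong[of "V - {v}" r' r] by (simp add: n_def r'_def)
    then have "bij_betw r' (insert v (V - {v})) (insert n {..<n})"
      using notIn_Un_bij_betw[of v "V - {v}" r' "{..<n}"] by (simp add: r'_def)
    moreover have "insert v (V - {v}) = V" using v by auto
    ultimately have bij': "bij_betw r' V {..<card V}"
      by (simp add: cV lessThan_Suc)
    have "card {e\<in>E. head e = w \<and> tail e \<in> V \<and> r' (tail e) < r' w} \<le> t" if w: "w \<in> V" for w
    proof (cases "w = v")
      case True
      have "card {e\<in>E. head e = w \<and> tail e \<in> V \<and> r' (tail e) < r' w}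
          \<le> card {e\<in>E. head e = v \<and> tail e \<in> V}"
        using assms(2) True by (intro card_mono) auto
      with v show ?thesis by simp
    next
      case False
      have "r w < n" using bij w False by (auto simp: bij_betw_def n_def)
      then have "{e\<in>E. head e = w \<and> tail e \<in> V \<and> r' (tail e) < r' w}
          = {e\<in>E. head e = w \<and> tail e \<in> V - {v} \<and> r (tail e) < r w}"
        using False by (auto simp: r'_def)
      then show ?thesis using r[of w] w False by simp
    qed
    with bij' show ?thesis by blast
  qed
qed

section \<open>Points and loop normals\<close>

text \<open>
  Points on the moment curve \<open>(x, x\<^sup>2, \<dots>, x\<^sup>d)\<close> are in general position. A linear relation among
  the differences \<open>p u - p w\<close> carries over from the monomials to all polynomials of degree at
  most \<open>d\<close>; evaluating it on the polynomial that vanishes at all the points but one isolates a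
  single coefficient.
\<close>

lemma general_position_points:
  fixes V :: "'v set"
  assumes "finite V"
  obtains p :: "'v \<Rightarrow> real ^ 'd" where
    "\<And>u S. u \<in> V \<Longrightarrow> S \<subseteq> V - {u} \<Longrightarrow> card S \<le> CARD('d) \<Longrightarrow>
       inj_on (\<lambda>w. p u - p w) S \<and> independent ((\<lambda>w. p u - p w) ` S)"
proof -
  obtain h0 where h0: "bij_betw h0 (UNIV :: 'd set) {..<CARD('d)}"
    using ex_bij_betw_finite_nat[of "UNIV :: 'd set"] by (auto simp: atLeast0LessThan)
  obtain xn :: "'v \<Rightarrow> nat" where "inj_on xn V"
    using finite_imp_inj_to_nat_seg[OF assms] by auto
  define x where "x v = real (xn v)" for v
  have inj: "inj_on x V" using \<open>inj_on xn V\<close> by (auto simp: inj_on_def x_def)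
  define p :: "'v \<Rightarrow> real ^ 'd" where "p v = (\<chi> i. x v ^ Suc (h0 i))" for v
  have relation_trivial: "c w0 = 0"
    if u: "u \<in> V" and S: "S \<subseteq> V - {u}" "card S \<le> CARD('d)"
      and rel: "(\<Sum>w\<in>S. c w *\<^sub>R (p u - p w)) = 0" and w0: "w0 \<in> S" for u S c w0
  proof -
    have finS: "finite S" using S assms finite_subset by auto
    have mono: "(\<Sum>w\<in>S. c w * (x u ^ i - x w ^ i)) = 0" if i: "i \<le> CARD('d)" for i
    proof (cases i)
      case (Suc j)
      then have "j \<in> h0 ` UNIV" using h0 i by (auto simp: bij_betw_def)
      then obtain k where "j = h0 k" by auto
      with arg_cong[OF rel, of "\<lambda>v. v $ k"] Suc show ?thesis by (simp add: p_def)
    qed simp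
    define f where "f = [:- x u, 1:] * (\<Prod>w\<in>S - {w0}. [:- x w, 1:])"
    have "degree f \<le> 1 + degree (\<Prod>w\<in>S - {w0}. [:- x w, 1:])"
      unfolding f_def by (rule order_trans[OF degree_mult_le]) simp
    moreover have "degree (\<Prod>w\<in>S - {w0}. [:- x w, 1:]) \<le> card (S - {w0})"
      using degree_prod_sum_le[of "S - {w0}" "\<lambda>w. [:- x w, 1:]"] finS by simp
    moreover have "card S = Suc (card (S - {w0}))"
      using w0 finS by (rule card.remove[rotated])
    ultimately have deg: "degree f \<le> CARD('d)" using S(2) by linarith
    have "(\<Sum>w\<in>S. c w * (poly f (x u) - poly f (x w)))
        = (\<Sum>w\<in>S. \<Sum>i\<le>degree f. coeff f i * (c w * (x u ^ i - x w ^ i)))"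
      unfolding poly_altdef sum_subtractf[symmetric] sum_distrib_left
      by (intro sum.cong) (auto simp: algebra_simps)
    also have "\<dots> = (\<Sum>i\<le>degree f. coeff f i * (\<Sum>w\<in>S. c w * (x u ^ i - x w ^ i)))"
      by (subst sum.swap) (simp add: sum_distrib_left)
    also have "\<dots> = 0" using mono deg by simp
    finally have "0 = (\<Sum>w\<in>S. c w * (poly f (x u) - poly f (x w)))" by simp
    also have "\<dots> = c w0 * (poly f (x u) - poly f (x w0))"
    proof (subst sum.remove[OF finS w0], subst sum.neutral)
      show "\<forall>w\<in>S - {w0}. c w * (poly f (x u) - poly f (x w)) = 0"
        using finS by (auto simp: f_def poly_prod)
    qed simp
    also have "poly f (x u) = 0" by (simp add: f_def)
    finally have "c w0 = 0 \<or> poly f (x w0) = 0" by auto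
    moreover have "poly f (x w0) \<noteq> 0"
    proof -
      have "x w0 \<noteq> x u" using inj u S w0 by (auto simp: inj_on_def)
      moreover have "x w0 \<noteq> x w" if "w \<in> S - {w0}" for w
        using inj S w0 that by (auto simp: inj_on_def)
      ultimately show ?thesis using finS by (auto simp: f_def poly_prod)
    qed
    ultimately show ?thesis by blast
  qed
  show thesis
  proof (rule that, rule conjI)
    fix u S assume u: "u \<in> V" and S: "S \<subseteq> V - {u}" "card S \<le> CARD('d)"
    have finS: "finite S" using S assms finite_subset by auto
    show inj_diff: "inj_on (\<lambda>w. p u - p w) S"
    proof (rule inj_onI, rule ccontr)
      fix v w assume vw: "v \<in> S" "w \<in> S" "p u - p v = p u - p w" "v \<noteq> w"
      define c :: "'v \<Rightarrow> real" where "c z = (if z = v then 1 else if z = w then -1 else 0)" for z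
      have "(\<Sum>z\<in>S. c z *\<^sub>R (p u - p z)) = (\<Sum>z\<in>{v, w}. c z *\<^sub>R (p u - p z))"
        using vw finS by (intro sum.mono_neutral_right) (auto simp: c_def)
      also have "\<dots> = 0" using vw by (simp add: c_def)
      finally have "c v = 0" using relation_trivial[OF u S _ vw(1)] by blast
      then show False by (simp add: c_def)
    qed
    show "independent ((\<lambda>w. p u - p w) ` S)"
    proof (rule independent_if_scalars_zero)
      fix g b assume sum: "(\<Sum>y\<in>(\<lambda>w. p u - p w) ` S. g y *\<^sub>R y) = 0"
        and b: "b \<in> (\<lambda>w. p u - p w) ` S"
      from sum have "(\<Sum>w\<in>S. g (p u - p w) *\<^sub>R (p u - p w)) = 0"
        by (simp add: sum.reindex[OF inj_diff])
      with relation_trivial[OF u S, of "\<lambda>w. g (p u - p w)"] b show "g b = 0" by blast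
    qed (use finS in simp)
  qed
qed

text \<open>
  The choice of normals at a single vertex. Extend the given vectors to a basis, hand \<open>card L\<close>
  of the new basis vectors to the loops in \<open>L\<close>, and hand the rest of the basis, except for
  the vectors of \<open>Out\<close>, to the remaining loops; their normals are \<open>h i\<close>.
\<close>

lemma complete_to_spanning_normals:
  fixes a :: "'v \<Rightarrow> 'a::euclidean_space" and L :: "'e set"
  assumes ind: "inj_on a (I \<union> Out)" "independent (a ` (I \<union> Out))"
    and fin: "finite I" "finite Out" "finite L" and disj: "I \<inter> Out = {}"
    and card: "card Out + card L = t" "card I + t \<le> DIM('a)"
  obtains g :: "'e \<Rightarrow> 'a" and h :: "nat \<Rightarrow> 'a" where
    "a ` I \<subseteq> h ` {..<DIM('a) - t}"
    "span (a ` Out \<union> g ` L \<union> h ` {..<DIM('a) - t}) = UNIV"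
proof -
  let ?S = "a ` (I \<union> Out)"
  obtain B where B: "?S \<subseteq> B" "independent B" "UNIV \<subseteq> span B"
    using maximal_independent_subset_extend[OF _ ind(2), of UNIV] by auto
  have finB: "finite B" using B(2) independent_imp_finite by blast
  have cardB: "card B = DIM('a)"
    using B basis_card_eq_dim[of B UNIV] by simp
  have cS: "card ?S = card I + card Out"
    using ind(1) fin disj by (simp add: card_image card_Un_disjoint)
  have cOut: "card (a ` Out) = card Out"
    using ind(1) by (intro card_image) (auto intro: inj_on_subset)
  have "card L \<le> card (B - ?S)"
    using B(1) finB cS cardB card by (simp add: card_Diff_subset finite_subset)
  then obtain R where R: "R \<subseteq> B - ?S" "card R = card L"
    by (meson obtain_subset_with_card_n)
  have finR: "finite R" using R finB finite_subset by blast
  define A where "A = B - a ` Out - R"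
  have "card A = card B - card (a ` Out \<union> R)"
  proof -
    have "A = B - (a ` Out \<union> R)" by (auto simp: A_def)
    moreover have "a ` Out \<union> R \<subseteq> B" using B(1) R by auto
    ultimately show ?thesis using fin finR by (simp add: card_Diff_subset)
  qed
  also have "card (a ` Out \<union> R) = t"
    using R finR fin cOut card by (subst card_Un_disjoint) auto
  finally have cA: "card A = DIM('a) - t" using cardB by simp
  have finA: "finite A" using finB by (simp add: A_def)
  obtain g where g: "bij_betw g L R"
    using finite_same_card_bij[OF fin(3) finR] R(2) by auto
  obtain h where h: "bij_betw h {..<DIM('a) - t} A"
    using finite_same_card_bij[OF _ finA, of "{..<DIM('a) - t}"] cA by auto
  have "a ` I \<inter> a ` Out = {}"
    using ind(1) disj by (auto simp: inj_on_def)
  then have "a ` I \<subseteq> A" using B(1) R by (auto simp: A_def)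
  moreover have "B \<subseteq> a ` Out \<union> R \<union> A" by (auto simp: A_def)
  then have "span (a ` Out \<union> R \<union> A) = UNIV"
    using B(3) span_mono by blast
  ultimately show thesis
    using that[of h g] g h by (simp add: bij_betw_def)
qed

lemma orthogonal_to_spanning_set_imp_zero:
  fixes y :: "'a::euclidean_space"
  assumes "span B = UNIV" "\<And>b. b \<in> B \<Longrightarrow> b \<bullet> y = 0"
  shows "y = 0"
proof -
  have "y \<in> span B" using assms(1) by simp
  then have "orthogonal y y"
    by (rule orthogonal_to_span) (use assms(2) in \<open>auto simp: orthogonal_def inner_commute\<close>)
  then show ?thesis by (simp add: orthogonal_def)
qed

text \<open>
  The given normals may be linearly dependent; in any case they span at most \<open>d - t\<close> dimensions,
  where \<open>d\<close> is the dimension of the space, and so leave at least \<open>t\<close> for their orthogonal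
  complement.
\<close>

lemma independent_directions_orthogonal_to:
  fixes q :: "nat \<Rightarrow> 'a::euclidean_space"
  assumes "t \<le> DIM('a)"
  obtains b :: "nat \<Rightarrow> 'a" where
    "\<And>i j. i < DIM('a) - t \<Longrightarrow> j < t \<Longrightarrow> q i \<bullet> b j = 0"
    "\<And>c. (\<Sum>j<t. c j *\<^sub>R b j) = 0 \<Longrightarrow> \<forall>j<t. c j = 0"
proof -
  let ?Q = "span (q ` {..<DIM('a) - t})"
  let ?U = "{y. \<forall>x\<in>?Q. orthogonal x y}"
  have "dim ?Q \<le> DIM('a) - t"
    using dim_le_card'[of "q ` {..<DIM('a) - t}"] card_image_le[of "{..<DIM('a) - t}" q] by simp
  moreover have "dim ?U + dim ?Q = DIM('a)"
    using dim_subspace_orthogonal_to_vectors[of ?Q UNIV] by simp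
  ultimately have "t \<le> dim ?U" using assms by simp
  moreover obtain B where B: "B \<subseteq> ?U" "independent B" "card B = dim ?U"
    by (rule basis_exists[of ?U])
  ultimately have "t \<le> card B" by linarith
  then obtain C where C: "C \<subseteq> B" "card C = t" "finite C"
    by (rule obtain_subset_with_card_n)
  obtain b where b: "bij_betw b {..<t} C"
    using finite_same_card_bij[of "{..<t}" C] C by auto
  show thesis
  proof (rule that)
    fix i j assume "i < DIM('a) - t" "j < t"
    then have "q i \<in> ?Q" "b j \<in> ?U"
      using b B C by (auto simp: bij_betw_def intro: span_base)
    then show "q i \<bullet> b j = 0" by (auto simp: orthogonal_def)
  next
    fix c assume c: "(\<Sum>j<t. c j *\<^sub>R b j) = 0"
    have inj: "inj_on b {..<t}" and im: "b ` {..<t} = C" using b by (auto simp: bij_betw_def)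
    define c' where "c' y = c (the_inv_into {..<t} b y)" for y
    have "(\<Sum>y\<in>C. c' y *\<^sub>R y) = (\<Sum>j<t. c j *\<^sub>R b j)"
      unfolding im[symmetric] sum.reindex[OF inj]
      by (intro sum.cong) (auto simp: c'_def the_inv_into_f_f[OF inj])
    with c have "(\<Sum>y\<in>C. c' y *\<^sub>R y) = 0" by simp
    then have "c' y = 0" if "y \<in> C" for y
      using independentD[OF independent_mono[OF B(2) C(1)] C(3) subset_refl] that by blast
    moreover have "c j = c' (b j)" if "j < t" for j
      using that by (simp add: c'_def the_inv_into_f_f[OF inj])
    ultimately show "\<forall>j<t. c j = 0" using im by auto
  qed
qed

section \<open>Rigidity and tight subgraphs\<close>

text \<open>
  The velocities vanish one vertex after the other along the order \<open>r\<close>. For an arc \<open>e\<close>, \<open>f e\<close> is the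
  vertex to which it is assigned and \<open>g e\<close> its other end. \<open>I v\<close> collects the earlier tails of arcs
  into \<open>v\<close>, and \<open>Out v\<close> all heads of arcs out of \<open>v\<close>.
\<close>

lemma tight_looped_simple_subgraph_imp_rigid:
  fixes G H :: "('v, 'e) multigraph"
  assumes sub: "spanning_subgraph H G" and simple: "looped_simple H" and tight: "tight t 0 H"
    and d: "2 * t \<le> CARD('d::finite)"
  shows "\<exists>(p :: 'v \<Rightarrow> real ^ 'd) q. infinitesimally_rigid (add_loops (CARD('d) - t) G) p q"
proof -
  define V E L where "V = verts H" and "E = edges H" and "L = loops H"
  have VG: "verts G = V" and EG: "E \<subseteq> edges G" "L \<subseteq> loops G"
    and endsG: "\<And>e. e \<in> E \<union> L \<Longrightarrow> ends G e = ends H e"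
    using sub by (auto simp: spanning_subgraph_def subgraph_def V_def E_def L_def)
  have mg: "is_multigraph H" and inj: "inj_on (ends H) E"
    using simple by (auto simp: looped_simple_def E_def)
  then have fin: "finite V" "finite E" "finite L"
    and endsV: "\<And>e. e \<in> E \<union> L \<Longrightarrow> ends H e \<subseteq> V"
    and card2: "\<And>e. e \<in> E \<Longrightarrow> card (ends H e) = 2"
    by (auto simp: is_multigraph_def V_def E_def L_def)
  have disj: "E \<inter> L = {}" using edges_loops_disjoint[OF mg] by (simp add: E_def L_def)
  have hall: "card F \<le> t * card (\<Union>(ends H ` F))" if "F \<subseteq> E \<union> L" for F
  proof (cases "F = {}")
    case False
    then have "int (card F) \<le> int (t * card (\<Union>(ends H ` F)))"
      using tight that by (simp add: tight_def sparse_def incident_verts_def E_def L_def)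
    then show ?thesis by linarith
  qed simp
  have "\<And>e. e \<in> E \<union> L \<Longrightarrow> finite (ends H e)" using endsV fin finite_subset by blast
  with capacitated_Hall[of "E \<union> L" "ends H" t] fin hall
  obtain f where f: "\<And>e. e \<in> E \<union> L \<Longrightarrow> f e \<in> ends H e"
    and out_le: "\<And>v. card {e \<in> E \<union> L. f e = v} \<le> t" by auto
  have fV: "f e \<in> V" if "e \<in> E \<union> L" for e using f endsV that by blast
  \<comment> \<open>By tightness the capacities are exhausted.\<close>
  have out_eq: "card {e \<in> E \<union> L. f e = v} = t" if v: "v \<in> V" for v
  proof (rule ccontr)
    assume "card {e \<in> E \<union> L. f e = v} \<noteq> t"
    then have "card {e \<in> E \<union> L. f e = v} < t" using out_le[of v] by simp
    then have "(\<Sum>v\<in>V. card {e \<in> E \<union> L. f e = v}) < (\<Sum>v\<in>V. t)"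
      using v fin out_le by (intro sum_strict_mono_ex1) auto
    moreover have "(\<Sum>v\<in>V. card {e \<in> E \<union> L. f e = v})
        = card (\<Union>v\<in>V. {e \<in> E \<union> L. f e = v})"
      using fin by (intro card_UN_disjoint[symmetric]) auto
    moreover have "(\<Union>v\<in>V. {e \<in> E \<union> L. f e = v}) = E \<union> L" using fV by auto
    moreover have "int (card (E \<union> L)) = int (t * card V)"
      using tight disj fin by (simp add: tight_def card_Un_disjoint V_def E_def L_def)
    ultimately show False by (simp add: mult.commute del: of_nat_mult)
  qed
  have "\<exists>w. ends H e = {f e, w} \<and> f e \<noteq> w" if "e \<in> E" for e
    using card2[OF that] f[of e] that by (auto simp: card_2_iff)
  then obtain g where g: "\<And>e. e \<in> E \<Longrightarrow> ends H e = {f e, g e}" "\<And>e. e \<in> E \<Longrightarrow> f e \<noteq> g e"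
    by metis
  have gV: "g e \<in> V" if "e \<in> E" for e using g(1)[OF that] endsV[of e] that by auto
  have "card {e\<in>E. f e = v} \<le> t" for v
    using card_mono[of "{e \<in> E \<union> L. f e = v}" "{e\<in>E. f e = v}"] fin out_le[of v] by fastforce
  from vertex_order_few_earlier_in_arcs[OF fin(1,2) this, of g]
  obtain r where r: "bij_betw r V {..<card V}"
    and in_le: "\<And>v. v \<in> V \<Longrightarrow>
      card {e\<in>E. g e = v \<and> f e \<in> V \<and> r (f e) < (r v :: nat)} \<le> t" by blast
  obtain p :: "'v \<Rightarrow> real ^ 'd" where p: "\<And>u S. u \<in> V \<Longrightarrow> S \<subseteq> V - {u} \<Longrightarrow> card S \<le> CARD('d) \<Longrightarrow>
       inj_on (\<lambda>w. p u - p w) S \<and> independent ((\<lambda>w. p u - p w) ` S)"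
    using general_position_points[OF fin(1)] by metis
  define I where "I v = f ` {e\<in>E. g e = v \<and> f e \<in> V \<and> r (f e) < r v}" for v
  define Out where "Out v = g ` {e\<in>E. f e = v}" for v
  define Lv where "Lv v = {e\<in>L. f e = v}" for v
  have "\<exists>gl h. (\<lambda>w. p v - p w) ` I v \<subseteq> h ` {..<CARD('d) - t} \<and>
      span ((\<lambda>w. p v - p w) ` Out v \<union> gl ` Lv v \<union> h ` {..<CARD('d) - t}) = UNIV"
    if v: "v \<in> V" for v
  proof -
    have finv: "finite (I v)" "finite (Out v)" "finite (Lv v)"
      using fin by (auto simp: I_def Out_def Lv_def)
    \<comment> \<open>As there are no parallel edges, the neighbours counted in \<open>I v\<close> and \<open>Out v\<close> are distinct.\<close>
    have "inj_on g {e\<in>E. f e = v}"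
      using inj g(1) by (auto simp: inj_on_def)
    then have "card (Out v) = card {e\<in>E. f e = v}"
      unfolding Out_def by (rule card_image)
    moreover have "card {e\<in>E. f e = v} + card (Lv v) = card {e \<in> E \<union> L. f e = v}"
      unfolding Lv_def using fin disj
      by (subst card_Un_disjoint[symmetric]) (auto intro: arg_cong[where f = card])
    ultimately have cO: "card (Out v) + card (Lv v) = t" using out_eq[OF v] by simp
    have cI: "card (I v) \<le> t"
      unfolding I_def using in_le[OF v] fin by (intro card_image_le[THEN order_trans]) auto
    have dj: "I v \<inter> Out v = {}"
    proof (rule equals0I)
      fix w assume "w \<in> I v \<inter> Out v"
      then obtain e e' where e: "e \<in> E" "g e = v" "f e = w" and e': "e' \<in> E" "f e' = v" "g e' = w"
        by (auto simp: I_def Out_def)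
      then have "ends H e = ends H e'" using g(1) by auto
      then have "e = e'" using inj e e' by (auto simp: inj_on_def)
      then show False using e(2) e'(2) g(2)[OF e(1)] by blast
    qed
    have sub: "I v \<union> Out v \<subseteq> V - {v}"
      using gV g(2) by (fastforce simp: I_def Out_def)
    have "card (I v \<union> Out v) \<le> CARD('d)"
      using card_Un_le[of "I v" "Out v"] cI cO d by linarith
    from p[OF v sub this] show ?thesis
      using complete_to_spanning_normals[of "\<lambda>w. p v - p w" "I v" "Out v" "Lv v" t]
        finv dj cO cI d by (auto simp: DIM_cart) metis
  qed
  then obtain gl h where
    gl_h: "\<And>v. v \<in> V \<Longrightarrow> (\<lambda>w. p v - p w) ` I v \<subseteq> h v ` {..<CARD('d) - t}"
      "\<And>v. v \<in> V \<Longrightarrow>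
        span ((\<lambda>w. p v - p w) ` Out v \<union> gl v ` Lv v \<union> h v ` {..<CARD('d) - t}) = UNIV"
    by metis
  define q :: "'e + 'v \<times> nat \<Rightarrow> real ^ 'd"
    where "q = case_sum (\<lambda>e. gl (f e) e) (\<lambda>(v, i). h v i)"
  have "infinitesimally_rigid (add_loops (CARD('d) - t) G) p q"
    unfolding infinitesimally_rigid_def
  proof (intro allI impI)
    fix p' assume "infinitesimal_motion (add_loops (CARD('d) - t) G) p q p'"
    then have
      edge0: "\<And>e u v. e \<in> edges G \<Longrightarrow> ends G e = {u, v} \<Longrightarrow> (p u - p v) \<bullet> (p' u - p' v) = 0"
      and loop0: "\<And>e v. e \<in> loops G \<Longrightarrow> v \<in> ends G e \<Longrightarrow> q (Inl e) \<bullet> p' v = 0"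
      and added0: "\<And>v i. v \<in> V \<Longrightarrow> i < CARD('d) - t \<Longrightarrow> q (Inr (v, i)) \<bullet> p' v = 0"
      by (auto simp: infinitesimal_motion_def add_loops_def VG)
    have edge: "(p (f e) - p (g e)) \<bullet> (p' (f e) - p' (g e)) = 0" if "e \<in> E" for e
      using edge0[of e] that EG endsG g(1) by auto
    have loop: "gl (f e) e \<bullet> p' (f e) = 0" if "e \<in> L" for e
      using loop0[of e "f e"] that EG endsG f by (auto simp: q_def)
    have added: "h v i \<bullet> p' v = 0" if "v \<in> V" "i < CARD('d) - t" for v i
      using added0[OF that] by (simp add: q_def)
    have "p' v = 0" if "v \<in> V" for v
      using that
    proof (induction "r v" arbitrary: v rule: less_induct)
      case (less v)
      have out: "(p v - p (g e)) \<bullet> p' v = 0" if e: "e \<in> E" "f e = v" for e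
      proof (cases "r (g e) < r v")
        case True
        then have "p' (g e) = 0" using less.hyps gV e by blast
        then show ?thesis using edge[OF e(1)] e by simp
      next
        case False
        \<comment> \<open>The velocity of a later head is orthogonal to the edge, by the choice of its added loops.\<close>
        have "r (g e) \<noteq> r v"
          using r less.prems gV[OF e(1)] g(2)[OF e(1)] e(2) by (auto simp: bij_betw_def inj_on_def)
        with False have "v \<in> I (g e)" using e less.prems by (auto simp: I_def)
        then have "p (g e) - p v \<in> h (g e) ` {..<CARD('d) - t}"
          using gl_h(1)[OF gV[OF e(1)]] by blast
        then have "(p (g e) - p v) \<bullet> p' (g e) = 0" using added gV[OF e(1)] by auto
        then show ?thesis using edge[OF e(1)] e by (simp add: inner_diff_left inner_diff_right)
      qed
      show "p' v = 0"
        by (rule orthogonal_to_spanning_set_imp_zero[OF gl_h(2)[OF less.prems]])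
          (use out loop added less.prems in \<open>auto simp: Out_def Lv_def\<close>)
    qed
    then show "\<forall>v\<in>verts (add_loops (CARD('d) - t) G). p' v = 0"
      by (simp add: add_loops_def VG)
  qed
  then show ?thesis by blast
qed

text \<open>
  The unknowns are the coordinates of the velocities in bases that the new loops cannot detect, so
  that only the edges and loops of \<open>G\<close> are left as equations. A solution is a motion, hence zero.
\<close>

lemma rigid_imp_tight_looped_simple_subgraph:
  fixes G :: "('v, 'e) multigraph" and p :: "'v \<Rightarrow> real ^ 'd"
  assumes G: "is_multigraph G" and t: "t \<le> CARD('d)"
    and rigid: "infinitesimally_rigid (add_loops (CARD('d) - t) G) p q"
  shows "\<exists>H. spanning_subgraph H G \<and> looped_simple H \<and> tight t 0 H"
proof -
  let ?V = "verts G" and ?Y = "edges G \<union> loops G" and ?X = "verts G \<times> {..<t}"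
  have fin: "finite ?V" "finite (edges G)" "finite (loops G)"
    and endsV: "\<And>e. e \<in> ?Y \<Longrightarrow> ends G e \<subseteq> ?V"
    and card2: "\<And>e. e \<in> edges G \<Longrightarrow> card (ends G e) = 2"
    and card1: "\<And>e. e \<in> loops G \<Longrightarrow> card (ends G e) = 1"
    using G by (auto simp: is_multigraph_def)
  have disj: "edges G \<inter> loops G = {}" using edges_loops_disjoint[OF G] .
  have "\<forall>v. \<exists>b. (\<forall>i<CARD('d) - t. \<forall>j<t. q (Inr (v, i)) \<bullet> b j = 0) \<and>
          (\<forall>c. (\<Sum>j<t. c j *\<^sub>R b j) = 0 \<longrightarrow> (\<forall>j<t. c j = 0))"
  proof
    fix v
    show "\<exists>b. (\<forall>i<CARD('d) - t. \<forall>j<t. q (Inr (v, i)) \<bullet> b j = 0) \<and>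
          (\<forall>c. (\<Sum>j<t. c j *\<^sub>R b j) = 0 \<longrightarrow> (\<forall>j<t. c j = 0))"
      by (rule independent_directions_orthogonal_to[of t "\<lambda>i. q (Inr (v, i))"])
        (use t in \<open>simp, simp, blast\<close>)
  qed
  then obtain b where
    b_orth: "\<And>v i j. i < CARD('d) - t \<Longrightarrow> j < t \<Longrightarrow> q (Inr (v, i)) \<bullet> b v j = 0" and
    b_ind: "\<And>v c. (\<Sum>j<t. c j *\<^sub>R b v j) = 0 \<Longrightarrow> \<forall>j<t. c j = 0"
    by metis
  \<comment> \<open>For an edge with ends \<open>v\<close> and \<open>w\<close>, the sum is \<open>p v - p w\<close>.\<close>
  define row where "row e v =
    (if v \<notin> ends G e then 0
     else if e \<in> loops G then q (Inl e) else (\<Sum>w\<in>ends G e. p v - p w))" for e v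
  define a where "a e = (\<lambda>(v, i). row e v \<bullet> b v i)" for e
  have ker: "\<forall>x\<in>?X. c x = 0" if c: "\<forall>e\<in>?Y. (\<Sum>x\<in>?X. a e x * c x) = 0" for c
  proof -
    define p' where "p' v = (\<Sum>i<t. c (v, i) *\<^sub>R b v i)" for v
    have zero: "(\<Sum>v\<in>ends G e. row e v \<bullet> p' v) = 0" if e: "e \<in> ?Y" for e
    proof -
      have "(\<Sum>v\<in>ends G e. row e v \<bullet> p' v) = (\<Sum>v\<in>?V. row e v \<bullet> p' v)"
        using endsV[OF e] fin by (intro sum.mono_neutral_left) (auto simp: row_def)
      also have "\<dots> = (\<Sum>v\<in>?V. \<Sum>i<t. a e (v, i) * c (v, i))"
        by (simp add: p'_def a_def inner_sum_right mult.commute)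
      also have "\<dots> = (\<Sum>x\<in>?X. a e x * c x)"
        by (simp add: sum.cartesian_product case_prod_beta)
      finally show ?thesis using c e by simp
    qed
    have "infinitesimal_motion (add_loops (CARD('d) - t) G) p q p'"
      unfolding infinitesimal_motion_def
    proof (intro conjI ballI allI impI)
      fix e u v
      assume "e \<in> edges (add_loops (CARD('d) - t) G)" "ends (add_loops (CARD('d) - t) G) e = {u, v}"
      then obtain e' where e': "e' \<in> edges G" "ends G e' = {u, v}"
        by (auto simp: add_loops_def)
      have "e' \<notin> loops G" "u \<noteq> v" using e' disj card2[of e'] by auto
      then have "row e' u = p u - p v" "row e' v = p v - p u"
        using e' by (simp_all add: row_def)
      with zero[of e'] e' \<open>u \<noteq> v\<close> show "(p u - p v) \<bullet> (p' u - p' v) = 0"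
        by (simp add: inner_diff_left inner_diff_right)
    next
      fix e v
      assume e: "e \<in> loops (add_loops (CARD('d) - t) G)" "v \<in> ends (add_loops (CARD('d) - t) G) e"
      show "q e \<bullet> p' v = 0"
      proof (cases e)
        case (Inl e')
        then have e': "e' \<in> loops G" "v \<in> ends G e'" using e by (auto simp: add_loops_def)
        then have "ends G e' = {v}" using card1[of e'] by (auto simp: card_1_singleton_iff)
        then show ?thesis using zero[of e'] e' Inl by (simp add: row_def)
      next
        case (Inr x)
        then obtain i where "e = Inr (v, i)" "i < CARD('d) - t" using e by (auto simp: add_loops_def)
        then show ?thesis by (simp add: p'_def inner_sum_right b_orth)
      qed
    qed
    then have "p' v = 0" if "v \<in> ?V" for v
      using rigid that by (auto simp: infinitesimally_rigid_def add_loops_def)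
    then have "\<forall>i<t. c (v, i) = 0" if "v \<in> ?V" for v
      using b_ind[of "\<lambda>i. c (v, i)" v] that by (simp add: p'_def)
    then show ?thesis by auto
  qed
  obtain F where F: "F \<subseteq> ?Y" and ind: "independent_rows a ?X F" and cF: "card F = card ?X"
    using trivial_kernel_imp_independent_rows[of ?Y ?X a] ker fin by auto
  have finF: "finite F" using F fin finite_subset by blast
  define H where "H = \<lparr>verts = ?V, edges = F \<inter> edges G, loops = F \<inter> loops G, ends = ends G\<rparr>"
  have FH: "edges H \<union> loops H = F" using F by (auto simp: H_def)
  have mgH: "is_multigraph H" using G by (auto simp: is_multigraph_def H_def)
  then have "spanning_subgraph H G"
    using G by (auto simp: spanning_subgraph_def subgraph_def H_def)
  moreover have "inj_on (ends H) (edges H)"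
  proof (rule inj_onI, rule ccontr)
    fix e e' assume e: "e \<in> edges H" "e' \<in> edges H" "ends H e = ends H e'" "e \<noteq> e'"
    \<comment> \<open>Parallel edges have equal rows, so their difference is a linear relation.\<close>
    then have "e \<in> F" "e' \<in> F" "e \<notin> loops G" "e' \<notin> loops G" "ends G e = ends G e'"
      using disj by (auto simp: H_def)
    then have same: "a e x = a e' x" for x by (cases x) (simp add: a_def row_def)
    define c :: "'e \<Rightarrow> real" where "c y = (if y = e then 1 else if y = e' then -1 else 0)" for y
    have "(\<Sum>y\<in>F. c y * a y x) = (\<Sum>y\<in>{e, e'}. c y * a y x)" for x
      using \<open>e \<in> F\<close> \<open>e' \<in> F\<close> finF by (intro sum.mono_neutral_right) (auto simp: c_def)
    then have "(\<Sum>y\<in>F. c y * a y x) = 0" for x using e(4) same by (simp add: c_def)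
    then have "c e = 0" using ind \<open>e \<in> F\<close> unfolding independent_rows_def by blast
    then show False by (simp add: c_def)
  qed
  then have "looped_simple H" using mgH by (simp add: looped_simple_def)
  moreover have "sparse t 0 H"
    unfolding sparse_def
  proof (intro allI impI)
    fix F' assume "F' \<noteq> {} \<and> F' \<subseteq> edges H \<union> loops H"
    then have F': "F' \<subseteq> F" using FH by simp
    have "incident_verts H F' \<subseteq> ?V"
      using F F' endsV by (fastforce simp: incident_verts_def H_def)
    then have "finite (incident_verts H F')" using fin finite_subset by blast
    then have "card F' \<le> card (incident_verts H F' \<times> {..<t})"
      by (intro independent_rows_card_le[OF ind finF _ F'])
        (auto simp: a_def row_def incident_verts_def H_def split: if_splits)
    then show "int (card F') \<le> int t * int (card (incident_verts H F')) - int 0"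
      by (simp add: card_cartesian_product mult.commute flip: of_nat_mult)
  qed
  moreover have "card (edges H) + card (loops H) = card F"
  proof -
    have "finite (edges H)" "finite (loops H)" "edges H \<inter> loops H = {}"
      using fin disj by (auto simp: H_def)
    then show ?thesis using FH card_Un_disjoint by metis
  qed
  then have "int (card (edges H)) + int (card (loops H)) = int t * int (card (verts H)) - int 0"
    using cF by (simp add: H_def card_cartesian_product mult.commute flip: of_nat_mult of_nat_add)
  ultimately show ?thesis by (auto simp: tight_def)
qed

theorem theorem1p2:
  fixes G :: "('v, 'e) multigraph" and t :: nat
  assumes "is_multigraph G"
    and "t > 0"
    and "CARD('d::finite) \<ge> max (2 * t) (t * (t - 1))"
  shows "(\<exists>(p :: 'v \<Rightarrow> real ^ 'd) (q :: 'e + 'v \<times> nat \<Rightarrow> real ^ 'd).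
            infinitesimally_rigid (add_loops (CARD('d) - t) G) p q)
         \<longleftrightarrow> (\<exists>H. spanning_subgraph H G \<and> looped_simple H \<and> tight t 0 H)"
proof -
  have d: "2 * t \<le> CARD('d)" "t \<le> CARD('d)" using assms(3) by auto
  show ?thesis
    using rigid_imp_tight_looped_simple_subgraph[OF assms(1) d(2)]
      tight_looped_simple_subgraph_imp_rigid[OF _ _ _ d(1)] by blast
qed

end
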